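(* Let $f_1,\dots,f_m\in C^2(\mathbb{R}^n)$ be such that $\|\nabla f_i(x)-\nabla f_i(y)\|\le L_i\|x-y\|$ for all $x,y\in\mathbb{R}^n$ and all $i$, with $L_i\ge 0$. Let $\tau>0$, $\delta>0$ and $z_k=(x_k,t_k)\in\mathbb{R}^n\times\mathbb{R}$. Then $$P_k-\nabla^2\Phi_\tau(z_k)\succeq \delta I_{n+1}.$$
   Context: $\succeq$ is the Loewner order on symmetric matrices. $\bar L=\sum_{i=1}^m L_i$. Hyperbolic smoothing: $\phi_\tau(r)=\frac{r+\sqrt{r^2+\tau^2}}{2}$, and $\Phi_\tau(x,t)=t+\sum_{i=1}^m\phi_\tau(f_i(x)-t)$ for $(x,t)\in\mathbb{R}^{n+1}$. At $z_k=(x_k,t_k)$ put $r_{i,k}=f_i(x_k)-t_k$, $\omega_{i,k}=\sqrt{r_{i,k}^2+\tau^2}$; $J_k$ is the $m\times(n+1)$ matrix whose $i$-th row is $(\nabla f_i(x_k)^T,\,-1)$; $D_k=\operatorname{diag}(\omega_{1,k}^{-1},\dots,\omega_{m,k}^{-1})$; $\Pi_x=\operatorname{diag}(I_n,0)\in\mathbb{R}^{(n+1)\times(n+1)}$. The metric is $P_k=\delta I_{n+1}+\bar L\,\Pi_x+\frac12J_k^TD_kJ_k$. *)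

theory Defs
  imports "HOL-Analysis.Analysis"
begin

definition gradient :: "('a::real_inner \<Rightarrow> real) \<Rightarrow> 'a \<Rightarrow> 'a" where
  "gradient g x = (THE D. GDERIV g x :> D)"

lemma gradient_eqI:
  assumes "GDERIV g x :> D"
  shows "gradient g x = D"
  unfolding gradient_def
proof (rule the_equality)
  fix E assume "GDERIV g x :> E"
  then have "(\<lambda>h. inner h E) = (\<lambda>h. inner h D)"
    using assms unfolding gderiv_def by (rule has_derivative_unique)
  then have "inner h (E - D) = 0" for h
    by (metis inner_diff_right right_minus_eq)
  then show "E = D"
    by (metis inner_eq_zero_iff right_minus_eq)
qed (rule assms)

definition hessian :: "(real ^ 'k \<Rightarrow> real) \<Rightarrow> real ^ 'k \<Rightarrow> real ^ 'k ^ 'k" where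
  "hessian g x = jacobian (gradient g) (at x)"

definition C2 :: "(real ^ 'k \<Rightarrow> real) \<Rightarrow> bool" where
  "C2 g \<longleftrightarrow> (\<forall>x. g differentiable (at x)) \<and> (\<forall>x. gradient g differentiable (at x))
     \<and> continuous_on UNIV (hessian g)"

(* A comparison also asserts that both sides are symmetric. *)
definition loewner_ge :: "real ^ 'k ^ 'k \<Rightarrow> real ^ 'k ^ 'k \<Rightarrow> bool" (infix \<open>\<succeq>\<close> 50) where
  "A \<succeq> B \<longleftrightarrow> transpose A = A \<and> transpose B = B \<and> (\<forall>v. 0 \<le> inner v ((A - B) *v v))"

definition diag :: "('k \<Rightarrow> real) \<Rightarrow> real ^ 'k ^ 'k" where
  "diag d = (\<chi> i j. if i = j then d i else 0)"

text \<open>If \<open>'n\<close> indexes the coordinates of \<open>x\<close>, then \<open>'n option\<close> indexes those of \<open>(x, t)\<close>: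
  \<open>Some j\<close> is the coordinate of \<open>x\<close> with index \<open>j\<close>, and \<open>None\<close> is the last coordinate \<open>t\<close>.\<close>

definition point :: "real ^ 'n \<Rightarrow> real \<Rightarrow> real ^ (('n::finite) option)" where
  "point x t = (\<chi> i. case i of Some j \<Rightarrow> x $ j | None \<Rightarrow> t)"

definition x_part :: "real ^ (('n::finite) option) \<Rightarrow> real ^ 'n" where
  "x_part z = (\<chi> j. z $ Some j)"

definition t_part :: "real ^ (('n::finite) option) \<Rightarrow> real" where
  "t_part z = z $ None"

lemma x_part_point [simp]: "x_part (point x t) = x"
  by (simp add: x_part_def point_def vec_eq_iff)

lemma t_part_point [simp]: "t_part (point x t) = t"
  by (simp add: t_part_def point_def)

lemma point_x_part_t_part [simp]: "point (x_part z) (t_part z) = z"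
  by (simp add: x_part_def t_part_def point_def vec_eq_iff split: option.split)

definition phi :: "real \<Rightarrow> real \<Rightarrow> real" where
  "phi \<tau> r = (r + sqrt (r\<^sup>2 + \<tau>\<^sup>2)) / 2"

definition Phi :: "real \<Rightarrow> ('m::finite \<Rightarrow> real ^ 'n \<Rightarrow> real) \<Rightarrow> real ^ (('n::finite) option) \<Rightarrow> real" where
  "Phi \<tau> f z = t_part z + (\<Sum>i\<in>UNIV. phi \<tau> (f i (x_part z) - t_part z))"

definition omega :: "real \<Rightarrow> ('m \<Rightarrow> real ^ 'n \<Rightarrow> real) \<Rightarrow> real ^ (('n::finite) option) \<Rightarrow> 'm \<Rightarrow> real" where
  "omega \<tau> f z i = sqrt ((f i (x_part z) - t_part z)\<^sup>2 + \<tau>\<^sup>2)"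

definition J_mat :: "('m \<Rightarrow> real ^ 'n \<Rightarrow> real) \<Rightarrow> real ^ (('n::finite) option) \<Rightarrow> real ^ (('n::finite) option) ^ 'm" where
  "J_mat f z = (\<chi> i. point (gradient (f i) (x_part z)) (- 1))"

definition D_mat :: "real \<Rightarrow> ('m \<Rightarrow> real ^ 'n \<Rightarrow> real) \<Rightarrow> real ^ (('n::finite) option) \<Rightarrow> real ^ 'm ^ 'm" where
  "D_mat \<tau> f z = diag (\<lambda>i. inverse (omega \<tau> f z i))"

definition Pi_x :: "real ^ (('n::finite) option) ^ (('n::finite) option)" where
  "Pi_x = diag (\<lambda>i. case i of Some j \<Rightarrow> 1 | None \<Rightarrow> 0)"

definition P_mat ::
  "real \<Rightarrow> ('m::finite \<Rightarrow> real) \<Rightarrow> real \<Rightarrow> ('m \<Rightarrow> real ^ 'n \<Rightarrow> real) \<Rightarrow> real ^ (('n::finite) option)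
     \<Rightarrow> real ^ (('n::finite) option) ^ (('n::finite) option)" where
  "P_mat \<delta> L \<tau> f z = \<delta> *\<^sub>R mat 1 + (\<Sum>i\<in>UNIV. L i) *\<^sub>R Pi_x
     + (1 / 2) *\<^sub>R (transpose (J_mat f z) ** D_mat \<tau> f z ** J_mat f z)"

end

theory Submission
  imports Defs
begin

text \<open>
  Write \<open>r\<^sub>i = f\<^sub>i(x) - t\<close>, and let \<open>J\<^sub>i\<close> be the gradient of \<open>r\<^sub>i\<close> with respect to \<open>(x, t)\<close>, which is
  the \<open>i\<close>-th row of \<open>J_mat\<close>. Differentiating \<open>\<Phi>\<close> twice gives (\<open>Phi_hessian_form\<close>)
  the bilinear form
  \<open>\<Sum>i. \<phi>''(r\<^sub>i) (J\<^sub>i \<bullet> u) (J\<^sub>i \<bullet> v) + \<phi>'(r\<^sub>i) (u\<^sub>x \<bullet> H\<^sub>i v\<^sub>x)\<close>,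
  where \<open>H\<^sub>i\<close> is the Hessian of \<open>f\<^sub>i\<close> at \<open>x\<close> and \<open>u\<^sub>x\<close>, \<open>v\<^sub>x\<close> are the \<open>x\<close>-parts of \<open>u\<close>, \<open>v\<close>. The
  form of the metric is
  \<open>\<delta> (u \<bullet> v) + (\<Sum>i. L\<^sub>i) (u\<^sub>x \<bullet> v\<^sub>x) + \<Sum>i. (J\<^sub>i \<bullet> u) (J\<^sub>i \<bullet> v) / (2 \<omega>\<^sub>i)\<close> (\<open>P_mat_form\<close>).

  On the diagonal \<open>u = v\<close> the metric dominates term by term. The curvature term is covered because
  \<open>\<phi>''(r) = \<tau>\<^sup>2 / (2 \<omega>\<^sup>3) \<le> 1 / (2 \<omega>)\<close>, as \<open>\<tau> \<le> \<omega>\<close>. The term with \<open>H\<^sub>i\<close> is covered because the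
  Lipschitz bound on the gradient of \<open>f\<^sub>i\<close> bounds \<open>H\<^sub>i\<close> in norm by \<open>L\<^sub>i\<close>
  (\<open>has_derivative_norm_le_Lipschitz\<close>) and \<open>0 \<le> \<phi>' \<le> 1\<close>. What remains is \<open>\<delta> (v \<bullet> v)\<close>.

  The Loewner order also requires the matrices to be symmetric, which for the metric minus the
  Hessian comes down to the symmetry of each \<open>H\<^sub>i\<close>, that is, to Schwarz's theorem
  (\<open>second_derivative_symmetric\<close>).
\<close>

section \<open>Gradients and second derivatives\<close>

text \<open>Riesz representation: a linear functional is the inner product with the value at \<open>1\<close> of its
  adjoint.\<close>

lemma GDERIV_gradient:
  fixes g :: "'a::euclidean_space \<Rightarrow> real"
  assumes "g differentiable (at x)"
  shows "GDERIV g x :> gradient g x"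
proof -
  from assms obtain g' where g': "(g has_derivative g') (at x)"
    by (auto simp: differentiable_def)
  have "g' = (\<lambda>h. inner h (adjoint g' 1))"
    using adjoint_works[OF has_derivative_linear[OF g'], of _ 1] by (intro ext) simp
  with g' have "GDERIV g x :> adjoint g' 1"
    unfolding gderiv_def by (rule has_derivative_subst)
  then show ?thesis
    by (simp only: gradient_eqI)
qed

lemma gradient_has_derivative_hessian:
  assumes "gradient g differentiable (at x)"
  shows "(gradient g has_derivative (*v) (hessian g x)) (at x)"
  using assms by (simp add: jacobian_works hessian_def)

text \<open>A Hessian can be computed by exhibiting the gradient as a function on the whole space and
  differentiating that function at the point.\<close>

lemma hessian_eqI:
  assumes "\<And>y. GDERIV g y :> G y" and "(G has_derivative H) (at x)"
  shows "hessian g x *v v = H v"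
proof -
  have "gradient g = G"
    using assms(1) by (auto intro: gradient_eqI)
  with assms(2) have "((\<lambda>y. gradient g y) has_derivative H) (at x)"
    by simp
  moreover from this have "(gradient g has_derivative (*v) (hessian g x)) (at x)"
    by (intro gradient_has_derivative_hessian) (auto simp: differentiable_def)
  ultimately have "(*v) (hessian g x) = H"
    by (intro has_derivative_unique)
  then show ?thesis
    by (rule fun_cong)
qed

text \<open>The quantitative heart of Schwarz's theorem. The second difference of \<open>g\<close> is symmetric in \<open>u\<close>
  and \<open>v\<close>, while the mean value theorem in direction \<open>u\<close> turns it into \<open>s\<close> times a first difference
  of \<open>G\<close> in direction \<open>v\<close>. Both points at which \<open>G\<close> is evaluated are close to \<open>x\<close>, so that only the
  linearisation of \<open>G\<close> at this single point enters. The hypothesis on \<open>G\<close> is the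
  \<open>\<epsilon>\<close>-\<open>\<delta>\<close> form of differentiability for a fixed accuracy \<open>e\<close>, so one radius \<open>d\<close> serves the
  applications both to \<open>(u, v)\<close> and to \<open>(v, u)\<close>.\<close>

lemma second_difference_estimate:
  fixes g :: "'a::real_inner \<Rightarrow> real"
  assumes g: "\<And>y. GDERIV g y :> G y"
    and H: "linear H"
    and G: "\<And>y. norm (y - x) < d \<Longrightarrow> norm (G y - G x - H (y - x)) \<le> e * norm (y - x)"
    and "0 \<le> e" "0 < s" and s: "s * (norm u + norm v) < d"
  shows "\<bar>g (x + s *\<^sub>R u + s *\<^sub>R v) - g (x + s *\<^sub>R u) - g (x + s *\<^sub>R v) + g x
           - s\<^sup>2 * inner u (H v)\<bar> \<le> 2 * e * s\<^sup>2 * (norm u + norm v)\<^sup>2"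
proof -
  let ?K = "norm u + norm v"
  define q where "q a = g (x + a *\<^sub>R u + s *\<^sub>R v) - g (x + a *\<^sub>R u)" for a
  have gd: "((\<lambda>a. g (c + a *\<^sub>R u)) has_real_derivative inner u (G (c + a *\<^sub>R u))) (at a)" for c a
  proof -
    have "((\<lambda>a. g (c + a *\<^sub>R u)) has_derivative (\<lambda>h. inner (h *\<^sub>R u) (G (c + a *\<^sub>R u)))) (at a)"
      by (rule has_derivative_compose[OF _ g[unfolded gderiv_def]])
        (auto intro!: derivative_eq_intros)
    then show ?thesis
      by (simp add: has_field_derivative_def mult_commute_abs)
  qed
  have qd: "(q has_real_derivative inner u (G (x + a *\<^sub>R u + s *\<^sub>R v) - G (x + a *\<^sub>R u))) (at a)" for a
    using DERIV_diff[OF gd[of "x + s *\<^sub>R v" a] gd[of x a]]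
    unfolding q_def by (simp add: inner_diff_right add_ac)
  obtain a where a: "0 < a" "a < s"
    and "q s - q 0 = (s - 0) * inner u (G (x + a *\<^sub>R u + s *\<^sub>R v) - G (x + a *\<^sub>R u))"
    using MVT2[OF \<open>0 < s\<close> qd] by blast
  then have q: "q s - q 0 = s * inner u (G (x + a *\<^sub>R u + s *\<^sub>R v) - G (x + a *\<^sub>R u))"
    by simp
  let ?y = "x + a *\<^sub>R u + s *\<^sub>R v" and ?w = "x + a *\<^sub>R u"
  have w: "norm (?w - x) \<le> s * ?K"
    using a by (auto simp: distrib_left intro!: add_increasing2 mult_right_mono)
  have "norm (?y - x) \<le> a * norm u + s * norm v"
    using norm_triangle_ineq[of "a *\<^sub>R u" "s *\<^sub>R v"] a by (simp add: add.assoc)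
  also have "\<dots> \<le> s * ?K"
    using a by (auto simp: distrib_left intro!: mult_right_mono)
  finally have y: "norm (?y - x) \<le> s * ?K" .
  \<comment> \<open>In the difference of the two linearisation errors, \<open>G x\<close> and the unknown multiple \<open>a *\<^sub>R H u\<close>
    cancel.\<close>
  have "norm (G ?y - G x - H (?y - x)) \<le> e * (s * ?K)"
    by (rule order_trans[OF G mult_left_mono]) (use y s \<open>0 \<le> e\<close> in auto)
  moreover have "norm (G ?w - G x - H (?w - x)) \<le> e * (s * ?K)"
    by (rule order_trans[OF G mult_left_mono]) (use w s \<open>0 \<le> e\<close> in auto)
  ultimately have "norm ((G ?y - G x - H (?y - x)) - (G ?w - G x - H (?w - x))) \<le> 2 * e * s * ?K"
    by (intro order_trans[OF norm_triangle_ineq4]) (simp add: algebra_simps)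
  moreover have "H (?y - x) = H (?w - x) + s *\<^sub>R H v"
    by (simp add: linear_add[OF H] linear_scale[OF H] add.assoc)
  then have "(G ?y - G x - H (?y - x)) - (G ?w - G x - H (?w - x)) = G ?y - G ?w - s *\<^sub>R H v"
    by (simp add: algebra_simps)
  ultimately have r: "norm (G ?y - G ?w - s *\<^sub>R H v) \<le> 2 * e * s * ?K"
    by (simp only:)
  have "q s - q 0 - s\<^sup>2 * inner u (H v) = s * inner u (G ?y - G ?w - s *\<^sub>R H v)"
    unfolding q by (simp add: inner_diff_right power2_eq_square right_diff_distrib)
  then have "\<bar>q s - q 0 - s\<^sup>2 * inner u (H v)\<bar> = s * \<bar>inner u (G ?y - G ?w - s *\<^sub>R H v)\<bar>"
    using \<open>0 < s\<close> by (simp only: abs_mult abs_of_pos)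
  also have "\<dots> \<le> s * (norm u * (2 * e * s * ?K))"
    using \<open>0 < s\<close> r
    by (intro mult_left_mono order_trans[OF Cauchy_Schwarz_ineq2]) auto
  also have "\<dots> \<le> s * (?K * (2 * e * s * ?K))"
    using \<open>0 < s\<close> \<open>0 \<le> e\<close> by (intro mult_left_mono mult_right_mono) auto
  finally show ?thesis
    unfolding q_def by (simp add: power2_eq_square algebra_simps)
qed

text \<open>Both mixed second derivatives approximate the same symmetric second difference divided by
  \<open>s\<^sup>2\<close>, with an error that is an arbitrarily small multiple of a constant.\<close>

lemma second_derivative_symmetric:
  fixes g :: "'a::real_inner \<Rightarrow> real"
  assumes g: "\<And>y. GDERIV g y :> G y" and G: "(G has_derivative H) (at x)"
  shows "inner u (H v) = inner v (H u)"
proof -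
  let ?K = "norm u + norm v"
  have H: "linear H"
    using G by (rule has_derivative_linear)
  have bound: "\<bar>inner u (H v) - inner v (H u)\<bar> \<le> e * (4 * ?K\<^sup>2)" if "0 < e" for e
  proof -
    obtain d where "0 < d"
      and d: "\<And>y. norm (y - x) < d \<Longrightarrow> norm (G y - G x - H (y - x)) \<le> e * norm (y - x)"
      using G \<open>0 < e\<close> unfolding has_derivative_at_alt by blast
    \<comment> \<open>Adding \<open>1\<close> to \<open>?K\<close> avoids a division by zero when \<open>u = v = 0\<close>.\<close>
    define s where "s = d / (2 * (?K + 1))"
    have c: "0 < 2 * (?K + 1)"
      by (intro mult_pos_pos add_nonneg_pos) simp_all
    with \<open>0 < d\<close> have "0 < s"
      unfolding s_def by (rule divide_pos_pos)
    have "2 * (s * ?K) + 2 * s = s * (2 * (?K + 1))"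
      by (simp add: algebra_simps)
    also have "\<dots> = d"
      using c nonzero_eq_divide_eq[of "2 * (?K + 1)" s d] by (simp add: s_def)
    finally have "2 * (s * ?K) + 2 * s = d" .
    moreover have "0 \<le> s * ?K"
      using \<open>0 < s\<close> by (intro mult_nonneg_nonneg add_nonneg_nonneg) auto
    ultimately have "s * ?K < d"
      using \<open>0 < s\<close> by linarith
    note est = second_difference_estimate[OF g H d less_imp_le[OF \<open>0 < e\<close>] \<open>0 < s\<close>]
    let ?A = "g (x + s *\<^sub>R u + s *\<^sub>R v) - g (x + s *\<^sub>R u) - g (x + s *\<^sub>R v) + g x"
    have "\<bar>?A - s\<^sup>2 * inner u (H v)\<bar> \<le> 2 * e * s\<^sup>2 * ?K\<^sup>2"
      using est[where u = u and v = v] \<open>s * ?K < d\<close> by simp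
    moreover have "\<bar>?A - s\<^sup>2 * inner v (H u)\<bar> \<le> 2 * e * s\<^sup>2 * ?K\<^sup>2"
      using est[where u = v and v = u] \<open>s * ?K < d\<close> by (simp add: add_ac algebra_simps)
    ultimately have "\<bar>s\<^sup>2 * inner u (H v) - s\<^sup>2 * inner v (H u)\<bar> \<le> 4 * e * s\<^sup>2 * ?K\<^sup>2"
      by linarith
    then have "s\<^sup>2 * \<bar>inner u (H v) - inner v (H u)\<bar> \<le> s\<^sup>2 * (e * (4 * ?K\<^sup>2))"
      by (simp add: abs_mult flip: right_diff_distrib) (simp add: mult_ac)
    then show ?thesis
      using \<open>0 < s\<close> by simp
  qed
  have "((\<lambda>e. e * (4 * ?K\<^sup>2)) \<longlongrightarrow> 0 * (4 * ?K\<^sup>2)) (at_right 0)"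
    by (intro tendsto_intros)
  moreover have "\<forall>\<^sub>F e in at_right 0. \<bar>inner u (H v) - inner v (H u)\<bar> \<le> e * (4 * ?K\<^sup>2)"
    using bound by (auto simp: eventually_at_filter)
  ultimately have "\<bar>inner u (H v) - inner v (H u)\<bar> \<le> 0 * (4 * ?K\<^sup>2)"
    by (rule tendsto_lowerbound) simp
  then show ?thesis
    by simp
qed

text \<open>The directional derivative is the limit of difference quotients, each of which is bounded by
  \<open>C * norm v\<close>.\<close>

lemma has_derivative_norm_le_Lipschitz:
  fixes G :: "'a::real_normed_vector \<Rightarrow> 'b::real_normed_vector"
  assumes G: "(G has_derivative H) (at x)"
    and Lip: "\<And>y. norm (G y - G x) \<le> C * norm (y - x)"
  shows "norm (H v) \<le> C * norm v"
proof -
  have "((\<lambda>s. G (x + s *\<^sub>R v)) has_derivative (\<lambda>s. H (s *\<^sub>R v))) (at 0)"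
    by (rule has_derivative_compose[where g = G]) (use G in \<open>auto intro!: derivative_eq_intros\<close>)
  then have lim: "((\<lambda>s. norm (G (x + s *\<^sub>R v) - G x - s *\<^sub>R H v) / \<bar>s\<bar>) \<longlongrightarrow> 0) (at (0::real))"
    by (simp add: has_derivative_iff_norm linear_scale[OF has_derivative_linear[OF G]])
  have le: "norm (H v) \<le> C * norm v + norm (G (x + s *\<^sub>R v) - G x - s *\<^sub>R H v) / \<bar>s\<bar>"
    if "s \<noteq> 0" for s :: real
  proof -
    have "norm (s *\<^sub>R H v) \<le> norm (G (x + s *\<^sub>R v) - G x) + norm (G (x + s *\<^sub>R v) - G x - s *\<^sub>R H v)"
      using norm_triangle_sub[of "s *\<^sub>R H v" "G (x + s *\<^sub>R v) - G x"] by (simp add: norm_minus_commute)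
    also have "norm (G (x + s *\<^sub>R v) - G x) \<le> C * (\<bar>s\<bar> * norm v)"
      using Lip[of "x + s *\<^sub>R v"] by simp
    finally show ?thesis
      using that by (simp add: field_simps)
  qed
  have "((\<lambda>s. C * norm v + norm (G (x + s *\<^sub>R v) - G x - s *\<^sub>R H v) / \<bar>s\<bar>)
      \<longlongrightarrow> C * norm v + 0) (at 0)"
    by (intro tendsto_intros lim)
  from tendsto_lowerbound[OF this, of "norm (H v)"] le show ?thesis
    by (auto simp: eventually_at_filter)
qed

section \<open>Points with an extra coordinate\<close>

lemma inner_option_split: 
  "inner u v = inner (x_part u) (x_part v) + t_part u * t_part v"
  by (simp add: inner_vec_def x_part_def t_part_def UNIV_option_conv sum.reindex add.commute)

lemma bounded_linear_x_part [bounded_linear]: "bounded_linear x_part"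
  by (intro linear_conv_bounded_linear[THEN iffD1] linearI) (simp_all add: x_part_def vec_eq_iff)

lemma bounded_linear_t_part [bounded_linear]: "bounded_linear t_part"
  by (intro linear_conv_bounded_linear[THEN iffD1] linearI) (simp_all add: t_part_def)

lemma bounded_linear_point_0 [bounded_linear]: "bounded_linear (\<lambda>w. point w 0)"
  by (intro linear_conv_bounded_linear[THEN iffD1] linearI)
    (simp_all add: point_def vec_eq_iff split: option.split)

lemma point_eq_add: "point w c = point w 0 + point 0 c"
  by (simp add: point_def vec_eq_iff split: option.split)

section \<open>The smoothed plus function\<close>

lemma sqrt_sum_squares_pos: "0 < (\<tau>::real) \<Longrightarrow> 0 < sqrt (r\<^sup>2 + \<tau>\<^sup>2)"
  by (simp add: add_nonneg_pos)

lemma phi_has_derivative: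
  assumes "0 < \<tau>"
  shows "(phi \<tau> has_real_derivative (1 + r / sqrt (r\<^sup>2 + \<tau>\<^sup>2)) / 2) (at r)"
proof -
  have "0 < r\<^sup>2 + \<tau>\<^sup>2"
    using assms by (simp add: add_nonneg_pos)
  then show ?thesis
    unfolding phi_def[abs_def]
    by (auto intro!: derivative_eq_intros simp: field_simps)
qed

lemma phi_has_second_derivative:
  assumes "0 < \<tau>"
  shows "((\<lambda>r. (1 + r / sqrt (r\<^sup>2 + \<tau>\<^sup>2)) / 2) has_real_derivative
           \<tau>\<^sup>2 / (2 * sqrt (r\<^sup>2 + \<tau>\<^sup>2) ^ 3)) (at r)"
proof -
  define w where "w = sqrt (r\<^sup>2 + \<tau>\<^sup>2)"
  have pos: "0 < r\<^sup>2 + \<tau>\<^sup>2"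
    using assms by (simp add: add_nonneg_pos)
  have w: "0 < w" "\<tau>\<^sup>2 = w\<^sup>2 - r\<^sup>2"
    using sqrt_sum_squares_pos[OF assms] by (simp_all add: w_def)
  \<comment> \<open>The quotient rule gives \<open>(w - r\<^sup>2 / w) / w\<^sup>2 = (w\<^sup>2 - r\<^sup>2) / w\<^sup>3\<close> as the derivative of \<open>r / w\<close>.\<close>
  have "((\<lambda>r. sqrt (r\<^sup>2 + \<tau>\<^sup>2)) has_real_derivative r / w) (at r)"
    using pos by (auto intro!: derivative_eq_intros simp: w_def field_simps)
  then have "((\<lambda>r. (1 + r / sqrt (r\<^sup>2 + \<tau>\<^sup>2)) / 2) has_real_derivative
      (0 + (1 * w - r * (r / w)) / (w * w)) / 2) (at r)"
    using \<open>0 < w\<close> unfolding w_def by (intro DERIV_add DERIV_divide DERIV_cdivide DERIV_const DERIV_ident) auto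
  moreover have "(0 + (1 * w - r * (r / w)) / (w * w)) / 2 = \<tau>\<^sup>2 / (2 * w ^ 3)"
    using \<open>0 < w\<close> unfolding w(2) by (simp add: field_simps power2_eq_square power3_eq_cube)
  ultimately show ?thesis
    by (simp only: w_def)
qed

lemma phi_derivative_bounds:
  assumes "0 < \<tau>"
  shows "0 \<le> (1 + r / sqrt (r\<^sup>2 + \<tau>\<^sup>2)) / 2" "(1 + r / sqrt (r\<^sup>2 + \<tau>\<^sup>2)) / 2 \<le> 1"
proof -
  define w where "w = sqrt (r\<^sup>2 + \<tau>\<^sup>2)"
  have "\<bar>r\<bar> \<le> w" unfolding w_def
    by (metis real_sqrt_abs real_sqrt_le_iff le_add_same_cancel1 zero_le_power2)
  moreover have "0 < w"
    using sqrt_sum_squares_pos[OF assms] by (simp add: w_def)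
  ultimately have "- 1 \<le> r / w" "r / w \<le> 1"
    by (simp_all add: pos_le_divide_eq pos_divide_le_eq)
  then show "0 \<le> (1 + r / sqrt (r\<^sup>2 + \<tau>\<^sup>2)) / 2" "(1 + r / sqrt (r\<^sup>2 + \<tau>\<^sup>2)) / 2 \<le> 1"
    by (simp_all add: w_def)
qed

lemma phi_second_derivative_le:
  assumes "0 < \<tau>"
  shows "\<tau>\<^sup>2 / (2 * sqrt (r\<^sup>2 + \<tau>\<^sup>2) ^ 3) \<le> inverse (sqrt (r\<^sup>2 + \<tau>\<^sup>2)) / 2"
proof -
  define w where "w = sqrt (r\<^sup>2 + \<tau>\<^sup>2)"
  have w: "0 < w"
    using sqrt_sum_squares_pos[OF assms] by (simp add: w_def)
  have "\<tau>\<^sup>2 \<le> w\<^sup>2"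
    by (simp add: w_def)
  then have "\<tau>\<^sup>2 / (2 * w ^ 3) \<le> w\<^sup>2 / (2 * w ^ 3)"
    using w by (intro divide_right_mono) auto
  also have "\<dots> = inverse w / 2"
    using w by (simp add: field_simps power2_eq_square power3_eq_cube)
  finally show ?thesis
    by (simp only: w_def)
qed

section \<open>The Hessian of the smoothed objective\<close>

lemma residual_has_derivative:
  assumes f: "\<And>y. GDERIV (f i) y :> gradient (f i) y"
  shows "((\<lambda>z. f i (x_part z) - t_part z) has_derivative inner (J_mat f z $ i)) (at z)"
proof -
  have "((\<lambda>z. f i (x_part z) - t_part z) has_derivative
      (\<lambda>h. inner (x_part h) (gradient (f i) (x_part z)) - t_part h)) (at z)"
    by (intro has_derivative_diff has_derivative_compose[OF _ f[unfolded gderiv_def]]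
        bounded_linear_imp_has_derivative bounded_linear_x_part bounded_linear_t_part)
  moreover have "(\<lambda>h. inner (x_part h) (gradient (f i) (x_part z)) - t_part h) = inner (J_mat f z $ i)"
    by (simp add: fun_eq_iff inner_option_split J_mat_def inner_commute)
  ultimately show ?thesis
    by simp
qed

text \<open>The summand \<open>point 0 1\<close> is the gradient of the linear term \<open>t\<close>; it is constant and so
  contributes nothing to the Hessian.\<close>

lemma GDERIV_Phi:
  fixes f :: "'m::finite \<Rightarrow> real ^ 'n \<Rightarrow> real"
  assumes "0 < \<tau>" and f: "\<And>i y. GDERIV (f i) y :> gradient (f i) y"
  shows "GDERIV (Phi \<tau> f) z :> point 0 1 +
           (\<Sum>i\<in>UNIV. ((1 + (f i (x_part z) - t_part z) / omega \<tau> f z i) / 2) *\<^sub>R J_mat f z $ i)"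
proof -
  have "((\<lambda>z. t_part z + (\<Sum>i\<in>UNIV. phi \<tau> (f i (x_part z) - t_part z))) has_derivative
      (\<lambda>h. t_part h + (\<Sum>i\<in>UNIV. (1 + (f i (x_part z) - t_part z) / omega \<tau> f z i) / 2
         * inner (J_mat f z $ i) h))) (at z)"
    unfolding omega_def
    by (intro has_derivative_add has_derivative_sum bounded_linear_imp_has_derivative
        bounded_linear_t_part
        has_derivative_compose[OF residual_has_derivative[OF f]
          phi_has_derivative[OF \<open>0 < \<tau>\<close>, unfolded has_field_derivative_def]])
  then show ?thesis
    unfolding gderiv_def Phi_def[abs_def]
    by (simp add: inner_add_right inner_sum_right inner_option_split[of _ "point _ _"]
        inner_commute)
qed

text \<open>The product rule splits the derivative of \<open>\<phi>'(r\<^sub>i) J\<^sub>i\<close> into a rank-one part from \<open>\<phi>'(r\<^sub>i)\<close> and a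
  part from \<open>J\<^sub>i\<close>, whose last coordinate is the constant \<open>- 1\<close>, so that only the \<open>x\<close>-parts meet the
  Hessian of \<open>f\<^sub>i\<close>. Stated as a bilinear form, the formula serves both symmetry and the
  comparison of quadratic forms.\<close>

lemma Phi_hessian_form:
  fixes f :: "'m::finite \<Rightarrow> real ^ 'n \<Rightarrow> real"
  assumes "0 < \<tau>" and f: "\<And>i. C2 (f i)"
  shows "inner u (hessian (Phi \<tau> f) z *v v) =
    (\<Sum>i\<in>UNIV. \<tau>\<^sup>2 / (2 * omega \<tau> f z i ^ 3) * inner (J_mat f z $ i) u * inner (J_mat f z $ i) v
       + (1 + (f i (x_part z) - t_part z) / omega \<tau> f z i) / 2
           * inner (x_part u) (hessian (f i) (x_part z) *v x_part v))"
proof -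
  have grad: "GDERIV (f i) y :> gradient (f i) y" for i y
    using f by (auto simp: C2_def intro: GDERIV_gradient)
  have hess: "(gradient (f i) has_derivative (*v) (hessian (f i) y)) (at y)" for i y
    using f by (auto simp: C2_def intro: gradient_has_derivative_hessian)
  have J: "((\<lambda>z. J_mat f z $ i) has_derivative (\<lambda>h. point (hessian (f i) (x_part z) *v x_part h) 0)) (at z)"
    for i
  proof -
    have "((\<lambda>z. point (gradient (f i) (x_part z)) 0 + point 0 (- 1)) has_derivative
        (\<lambda>h. point (hessian (f i) (x_part z) *v x_part h) 0 + 0)) (at z)"
      by (intro has_derivative_add has_derivative_const
          bounded_linear.has_derivative[OF bounded_linear_point_0] has_derivative_compose[OF _ hess]
          bounded_linear_imp_has_derivative bounded_linear_x_part)
    then show ?thesis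
      by (simp add: J_mat_def point_eq_add[of _ "- 1", symmetric])
  qed
  have "((\<lambda>z. point 0 1 +
      (\<Sum>i\<in>UNIV. ((1 + (f i (x_part z) - t_part z) / omega \<tau> f z i) / 2) *\<^sub>R J_mat f z $ i))
    has_derivative (\<lambda>h. 0 + (\<Sum>i\<in>UNIV.
      ((1 + (f i (x_part z) - t_part z) / omega \<tau> f z i) / 2) *\<^sub>R point (hessian (f i) (x_part z) *v x_part h) 0
      + (\<tau>\<^sup>2 / (2 * omega \<tau> f z i ^ 3) * inner (J_mat f z $ i) h) *\<^sub>R J_mat f z $ i))) (at z)"
    unfolding omega_def
    by (intro has_derivative_add has_derivative_sum has_derivative_const has_derivative_scaleR J
        has_derivative_compose[OF residual_has_derivative[OF grad]
          phi_has_second_derivative[OF \<open>0 < \<tau>\<close>, unfolded has_field_derivative_def]])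
  from hessian_eqI[OF GDERIV_Phi[OF \<open>0 < \<tau>\<close> grad] this, of v]
  show ?thesis
    by (simp add: inner_sum_right inner_add_right inner_option_split[of _ "point _ _"]
        inner_commute mult_ac add.commute)
qed

section \<open>The metric\<close>

lemma symmetric_matrix_iff:
  fixes A :: "real ^ 'k ^ 'k"
  shows "transpose A = A \<longleftrightarrow> (\<forall>u v. inner u (A *v v) = inner v (A *v u))"
proof -
  have "inner u (transpose A *v v) = inner v (A *v u)" for u v
    by (metis dot_lmul_matrix inner_commute transpose_matrix_vector)
  then show ?thesis
    by (metis matrix_eq vector_eq_ldot)
qed

lemma inner_diag: "inner u (diag d *v v) = (\<Sum>i\<in>UNIV. d i * u $ i * v $ i)"
proof -
  have "(diag d *v v) $ i = d i * v $ i" for i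
    by (simp add: diag_def matrix_vector_mult_def if_distrib[of "\<lambda>c. c * _"] cong: if_cong)
  then show ?thesis
    by (simp add: inner_vec_def mult_ac)
qed

lemma P_mat_form:
  fixes f :: "'m::finite \<Rightarrow> real ^ 'n \<Rightarrow> real"
  shows "inner u (P_mat \<delta> L \<tau> f z *v v) =
    \<delta> * inner u v + (\<Sum>i\<in>UNIV. L i) * inner (x_part u) (x_part v)
    + (\<Sum>i\<in>UNIV. inverse (omega \<tau> f z i) / 2 * inner (J_mat f z $ i) u * inner (J_mat f z $ i) v)"
proof -
  have "inner u (Pi_x *v v) = inner (x_part u) (x_part v)"
    by (simp add: Pi_x_def inner_diag)
      (simp add: inner_vec_def x_part_def UNIV_option_conv sum.reindex)
  moreover have "inner u ((transpose (J_mat f z) ** D_mat \<tau> f z ** J_mat f z) *v v)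
      = inner (J_mat f z *v u) (D_mat \<tau> f z *v (J_mat f z *v v))"
    by (metis dot_lmul_matrix inner_commute transpose_matrix_vector matrix_vector_mul_assoc)
  ultimately show ?thesis
    by (simp add: P_mat_def matrix_vector_mult_add_rdistrib inner_add_right
        scaleR_matrix_vector_assoc[symmetric] D_mat_def inner_diag
        matrix_vector_mul_component sum_distrib_left sum_divide_distrib mult_ac)
qed

theorem theorem3p2:
  fixes f :: "'m::finite \<Rightarrow> real ^ 'n \<Rightarrow> real"
    and L :: "'m \<Rightarrow> real"
    and \<tau> \<delta> t :: real
    and x :: "real ^ 'n"
  assumes "\<And>i. C2 (f i)"
    and "\<And>i. L i \<ge> 0"
    and "\<And>i y y'. norm (gradient (f i) y - gradient (f i) y') \<le> L i * norm (y - y')"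
    and "\<tau> > 0"
    and "\<delta> > 0"
  shows "P_mat \<delta> L \<tau> f (point x t) - hessian (Phi \<tau> f) (point x t) \<succeq> \<delta> *\<^sub>R mat 1"
proof -
  let ?z = "point x t"
  let ?M = "P_mat \<delta> L \<tau> f ?z - hessian (Phi \<tau> f) ?z"
  have hess: "(gradient (f i) has_derivative (*v) (hessian (f i) x)) (at x)" for i
    using assms(1) by (auto simp: C2_def intro: gradient_has_derivative_hessian)
  have sym: "inner u (hessian (f i) x *v v) = inner v (hessian (f i) x *v u)" for i u v
    by (rule second_derivative_symmetric[OF GDERIV_gradient hess]) (use assms(1) in \<open>simp add: C2_def\<close>)
  have bound: "inner v (hessian (f i) x *v v) \<le> L i * inner v v" for i v
  proof -
    have "norm (hessian (f i) x *v v) \<le> L i * norm v"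
      using has_derivative_norm_le_Lipschitz[OF hess assms(3)] .
    then have "norm v * norm (hessian (f i) x *v v) \<le> norm v * (L i * norm v)"
      by (intro mult_left_mono) auto
    then show ?thesis
      using norm_cauchy_schwarz[of v "hessian (f i) x *v v"]
      by (simp add: power2_norm_eq_inner[symmetric] power2_eq_square mult_ac)
  qed
  have form: "inner u (?M *v v) = inner u (P_mat \<delta> L \<tau> f ?z *v v) - inner u (hessian (Phi \<tau> f) ?z *v v)" for u v
    by (simp add: matrix_vector_mult_diff_rdistrib inner_diff_right)
  have "transpose ?M = ?M"
    unfolding symmetric_matrix_iff form P_mat_form Phi_hessian_form[OF assms(4,1)]
    by (simp add: sym inner_commute mult_ac)
  moreover have "transpose (\<delta> *\<^sub>R mat 1) = (\<delta> *\<^sub>R mat 1 :: real ^ 'n option ^ 'n option)"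
    by (simp add: transpose_scalar)
  moreover have "0 \<le> inner v ((?M - \<delta> *\<^sub>R mat 1) *v v)" for v
  proof -
    let ?y = "x_part v"
    have "(\<Sum>i\<in>UNIV. \<tau>\<^sup>2 / (2 * omega \<tau> f ?z i ^ 3) * inner (J_mat f ?z $ i) v * inner (J_mat f ?z $ i) v
          + (1 + (f i x - t) / omega \<tau> f ?z i) / 2 * inner ?y (hessian (f i) x *v ?y))
       \<le> (\<Sum>i\<in>UNIV. inverse (omega \<tau> f ?z i) / 2 * inner (J_mat f ?z $ i) v * inner (J_mat f ?z $ i) v
          + L i * inner ?y ?y)"
    proof (intro sum_mono add_mono)
      fix i
      show "\<tau>\<^sup>2 / (2 * omega \<tau> f ?z i ^ 3) * inner (J_mat f ?z $ i) v * inner (J_mat f ?z $ i) v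
         \<le> inverse (omega \<tau> f ?z i) / 2 * inner (J_mat f ?z $ i) v * inner (J_mat f ?z $ i) v"
        using mult_right_mono[OF phi_second_derivative_le[OF \<open>\<tau> > 0\<close>],
            of "inner (J_mat f ?z $ i) v * inner (J_mat f ?z $ i) v"]
        by (simp add: omega_def mult.assoc)
      let ?p = "(1 + (f i x - t) / omega \<tau> f ?z i) / 2"
      have p: "0 \<le> ?p" "?p \<le> 1"
        using phi_derivative_bounds[OF \<open>\<tau> > 0\<close>] by (simp_all add: omega_def)
      have "?p * inner ?y (hessian (f i) x *v ?y) \<le> ?p * (L i * inner ?y ?y)"
        using bound p(1) by (rule mult_left_mono)
      also have "\<dots> \<le> 1 * (L i * inner ?y ?y)"
        using p(2) assms(2) by (intro mult_right_mono) auto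
      finally show "?p * inner ?y (hessian (f i) x *v ?y) \<le> L i * inner ?y ?y"
        by simp
    qed
    then show ?thesis
      unfolding matrix_vector_mult_diff_rdistrib[of ?M] inner_diff_right form P_mat_form
        Phi_hessian_form[OF assms(4,1)]
      by (simp add: sum.distrib sum_distrib_right scaleR_matrix_vector_assoc[symmetric])
  qed
  ultimately show ?thesis
    unfolding loewner_ge_def by blast
qed

end
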